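(* Let $d,n\ge 1$ be integers, let $\sigma>0$, and let $\mathcal{P}$ be a class of probability measures on $\mathbb{R}^d$ with finite second moments that is closed under domination. Let $y_1,\dots,y_n\in\mathbb{R}^d$ be the observed values of $Y_1,\dots,Y_n$ in the Gaussian deconvolution model with noise variance $\sigma^2$. Then the maximum-likelihood estimator over $\mathcal{P}$, $$\hat P=\operatorname*{argmax}_{P\in\mathcal{P}}\ \sum_{i=1}^n\log\big(\varphi_\sigma\star \mathrm{d}P\big)(y_i),$$ satisfies $$\hat P=\operatorname*{argmin}_{P\in\mathcal{P}}\ W_{\sigma^2}\Big(P,\frac1n\sum_{i=1}^n\delta_{y_i}\Big).$$ (The equality of argmax and argmin is understood as follows: a measure in $\mathcal{P}$ attains the maximum of the first objective over $\mathcal{P}$ if and only if it attains the minimum of the second objective over $\mathcal{P}$.)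
   Context: Notation: $\|\cdot\|$ is the Euclidean norm on $\mathbb{R}^d$ and $\delta_y$ is the Dirac mass at $y$. Gaussian deconvolution model: one observes $Y_i=X_i+Z_i$, $i=1,\dots,n$, where the $X_i$ have an unknown distribution $P^*$ on $\mathbb{R}^d$ with finite second moment, and the errors $Z_1,\dots,Z_n$ are independent of $X_1,\dots,X_n$ and are i.i.d. centered Gaussian $\mathcal{N}(0,\sigma^2 I_d)$ on $\mathbb{R}^d$, with $\sigma^2$ known. The density of $\mathcal{N}(0,\sigma^2 I_d)$ is denoted $\varphi_\sigma$, and for a probability measure $P$ on $\mathbb{R}^d$, $$(\varphi_\sigma\star \mathrm{d}P)(y)=\int\varphi_\sigma(y-x)\,\mathrm{d}P(x).$$ The statement concerns an arbitrary realization $y_1,\dots,y_n$ of the observations; $P^*$ is not required to belong to $\mathcal{P}$. Closed under domination: a class $\mathcal{P}$ of probability measures is closed under domination if, whenever $Q$ is a probability measure with $Q\ll P$ for some $P\in\mathcal{P}$, then $Q\in\mathcal{P}$. Kullback–Leibler divergence: $D(\mu\,\|\,\nu)=\int\log\frac{\mathrm{d}\mu}{\mathrm{d}\nu}\,\mathrm{d}\mu$ if $\mu\ll\nu$, and $+\infty$ otherwise. For a probability measure $\gamma$ on $\mathbb{R}^d\times\mathbb{R}^d$, $\pi_X\gamma$ and $\pi_Y\gamma$ denote its first and second marginals, and the mutual information is $I(\gamma)=D(\gamma\,\|\,\pi_X\gamma\otimes\pi_Y\gamma)$. Entropic optimal transport distance: for probability measures $\mu,\nu$ on $\mathbb{R}^d$,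 $$W_{\sigma^2}(\mu,\nu)=\min_{\gamma\in\mathcal{M}(\mu,\nu)}\int\frac12\|x-y\|^2\,\mathrm{d}\gamma(x,y)+\sigma^2 I(\gamma),\qquad \mathcal{M}(\mu,\nu)=\{\gamma:\pi_X\gamma=\mu,\ \pi_Y\gamma=\nu\}.$$ *)

theory Defs
  imports "HOL-Probability.Probability"
begin

text \<open>Density of the centred Gaussian with covariance \<open>\<sigma>\<^sup>2 I\<close> on \<open>\<real>\<^sup>d\<close>.\<close>

definition gauss_density :: "real \<Rightarrow> real ^ 'd \<Rightarrow> real" where
  "gauss_density \<sigma> x =
     exp (- (norm x)\<^sup>2 / (2 * \<sigma>\<^sup>2)) / sqrt (2 * pi * \<sigma>\<^sup>2) ^ CARD('d)"

lemma gauss_density_eq_prod_normal_density: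
  "gauss_density \<sigma> (x :: real ^ 'd) = (\<Prod>j\<in>UNIV. normal_density 0 \<sigma> (x $ j))"
proof -
  have norm_sq: "(norm x)\<^sup>2 = (\<Sum>j\<in>UNIV. (x $ j)\<^sup>2)"
    by (simp add: norm_vec_def L2_set_def sum_nonneg)
  have "(\<Prod>j\<in>UNIV. normal_density 0 \<sigma> (x $ j)) =
      (\<Prod>j\<in>(UNIV :: 'd set). 1 / sqrt (2 * pi * \<sigma>\<^sup>2)) *
      (\<Prod>j\<in>UNIV. exp (- (x $ j)\<^sup>2 / (2 * \<sigma>\<^sup>2)))"
    unfolding normal_density_def by (simp only: prod.distrib diff_0_right)
  also have "(\<Prod>j\<in>UNIV. exp (- (x $ j)\<^sup>2 / (2 * \<sigma>\<^sup>2))) =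
      exp (\<Sum>j\<in>UNIV. - (x $ j)\<^sup>2 / (2 * \<sigma>\<^sup>2))"
    by (rule exp_sum[symmetric]) (rule finite)
  also have "(\<Sum>j\<in>UNIV. - (x $ j)\<^sup>2 / (2 * \<sigma>\<^sup>2)) = - (norm x)\<^sup>2 / (2 * \<sigma>\<^sup>2)"
    by (simp only: norm_sq sum_divide_distrib[symmetric] sum_negf)
  also have "(\<Prod>j\<in>(UNIV :: 'd set). 1 / sqrt (2 * pi * \<sigma>\<^sup>2)) =
      1 / sqrt (2 * pi * \<sigma>\<^sup>2) ^ CARD('d)"
    by (simp only: prod_constant power_one_over)
  finally show ?thesis
    by (simp add: gauss_density_def)
qed

definition gauss_conv :: "real \<Rightarrow> (real ^ 'd) measure \<Rightarrow> real ^ 'd \<Rightarrow> real" where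
  "gauss_conv \<sigma> P y = (\<integral>x. gauss_density \<sigma> (y - x) \<partial>P)"

definition log_likelihood ::
    "real \<Rightarrow> nat \<Rightarrow> (nat \<Rightarrow> real ^ 'd) \<Rightarrow> (real ^ 'd) measure \<Rightarrow> real" where
  "log_likelihood \<sigma> n y P = (\<Sum>i=1..n. ln (gauss_conv \<sigma> P (y i)))"

definition closed_under_domination :: "'a measure set \<Rightarrow> bool" where
  "closed_under_domination \<P> \<longleftrightarrow>
     (\<forall>P\<in>\<P>. \<forall>Q. prob_space Q \<longrightarrow> sets Q = sets P \<longrightarrow> absolutely_continuous P Q \<longrightarrow> Q \<in> \<P>)"

text \<open>
  The Bochner integral is \<open>0\<close> on non-integrable functions, which would assign a finite value to an
  infinite divergence; hence the extended Lebesgue integral (positive part minus negative part;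
  \<open>ennreal\<close> truncates negative reals to \<open>0\<close>).  The ill-defined case \<open>\<infinity> - \<infinity>\<close> does not occur below:
  the negative part of \<open>log (d\<mu>/d\<nu>)\<close> has \<open>\<mu>\<close>-integral at most \<open>1/e\<close> for probability measures.
\<close>

definition ext_integral :: "'a measure \<Rightarrow> ('a \<Rightarrow> real) \<Rightarrow> ereal" where
  "ext_integral M f =
     enn2ereal (\<integral>\<^sup>+x. ennreal (f x) \<partial>M) - enn2ereal (\<integral>\<^sup>+x. ennreal (- f x) \<partial>M)"

lemma ext_integral_eq_lebesgue_integral:
  assumes "integrable M f"
  shows "ext_integral M f = ereal (\<integral>x. f x \<partial>M)"
proof -
  have "(\<integral>\<^sup>+x. ennreal (f x) \<partial>M) \<noteq> \<infinity>" "(\<integral>\<^sup>+x. ennreal (- f x) \<partial>M) \<noteq> \<infinity>"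
    using assms by (auto simp: real_integrable_def)
  then show ?thesis
    unfolding ext_integral_def real_lebesgue_integral_def[OF assms]
    by (cases "\<integral>\<^sup>+x. ennreal (f x) \<partial>M"; cases "\<integral>\<^sup>+x. ennreal (- f x) \<partial>M")
       (auto simp: enn2ereal_ennreal)
qed

text \<open>
  Library argument orders: \<open>absolutely_continuous \<nu> \<mu>\<close> is \<open>\<mu> \<lless> \<nu>\<close>, and \<open>RN_deriv \<nu> \<mu>\<close> is
  \<open>d\<mu>/d\<nu>\<close>.
\<close>

definition KL_div :: "'a measure \<Rightarrow> 'a measure \<Rightarrow> ereal" where
  "KL_div \<mu> \<nu> =
     (if absolutely_continuous \<nu> \<mu>
      then ext_integral \<mu> (\<lambda>x. ln (enn2real (RN_deriv \<nu> \<mu> x))) else \<infinity>)"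

definition mutual_info :: "('a::topological_space \<times> 'b::topological_space) measure \<Rightarrow> ereal" where
  "mutual_info \<gamma> = KL_div \<gamma> (distr \<gamma> borel fst \<Otimes>\<^sub>M distr \<gamma> borel snd)"

definition couplings ::
    "'a::topological_space measure \<Rightarrow> 'b::topological_space measure \<Rightarrow> ('a \<times> 'b) measure set" where
  "couplings \<mu> \<nu> =
     {\<gamma>. prob_space \<gamma> \<and> sets \<gamma> = sets (borel \<Otimes>\<^sub>M borel) \<and>
         distr \<gamma> borel fst = \<mu> \<and> distr \<gamma> borel snd = \<nu>}"

text \<open>Entropic optimal transport cost with regularization parameter \<open>\<epsilon>\<close> (to be taken as \<open>\<sigma>\<^sup>2\<close>).\<close>

definition entropic_OT :: "real \<Rightarrow> (real ^ 'd) measure \<Rightarrow> (real ^ 'd) measure \<Rightarrow> ereal" where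
  "entropic_OT \<epsilon> \<mu> \<nu> =
     (INF \<gamma>\<in>couplings \<mu> \<nu>.
        enn2ereal (\<integral>\<^sup>+(x, y). ennreal ((norm (x - y))\<^sup>2 / 2) \<partial>\<gamma>) + ereal \<epsilon> * mutual_info \<gamma>)"

text \<open>
  \<open>(1/n) \<Sum>\<^sub>i \<delta>\<^bsub>y i\<^esub>\<close>, as the image of the uniform distribution on the index set, so that repeated
  observations are counted with multiplicity.
\<close>

definition empirical_measure :: "nat \<Rightarrow> (nat \<Rightarrow> 'a::topological_space) \<Rightarrow> 'a measure" where
  "empirical_measure n y = distr (uniform_count_measure {1..n}) borel y"

lemma emeasure_empirical_measure:
  assumes "n \<ge> 1" and "A \<in> sets borel"
  shows "emeasure (empirical_measure n y) A =
           ennreal (1 / real n) * (\<Sum>i=1..n. emeasure (return borel (y i)) A)"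
proof -
  have "emeasure (empirical_measure n y) A =
      emeasure (uniform_count_measure {1..n}) (y -` A \<inter> {1..n})"
    unfolding empirical_measure_def using assms(2)
    by (subst emeasure_distr) (auto simp: space_uniform_count_measure measurable_def
        sets_uniform_count_measure)
  also have "\<dots> = ennreal (real (card (y -` A \<inter> {1..n})) / real n)"
    by (subst emeasure_uniform_count_measure) auto
  also have "\<dots> = ennreal (1 / real n) * ennreal (real (card (y -` A \<inter> {1..n})))"
    by (simp flip: ennreal_mult)
  also have "ennreal (real (card (y -` A \<inter> {1..n}))) = (\<Sum>i=1..n. indicator A (y i))"
    by (simp add: indicator_def sum.If_cases Int_def vimage_def conj_commute
        ennreal_of_nat_eq_real_of_nat)
  finally show ?thesis
    using assms(2) by simp
qed

end

theory Submission imports Defs begin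

text \<open>
  Write \<open>Q\<close> for the empirical measure and \<open>L P\<close> for the rescaled negative log-likelihood.  Gibbs'
  inequality with the density \<open>k (x, b) = \<phi>\<^sub>\<sigma> (b - x) / (\<phi>\<^sub>\<sigma> \<star> P) b\<close> with respect to \<open>P \<otimes> Q\<close> gives
  \<open>L P \<le> W (P, Q)\<close>.  Conversely, the coupling with density \<open>k\<close> has second marginal \<open>Q\<close>, and its first
  marginal is the EM update \<open>P' = f P\<close>, where \<open>f x = \<integral> k (x, b) dQ b\<close>; its cost shows
  \<open>W (P', Q) \<le> L P - \<sigma>\<^sup>2 D(P' \<parallel> P)\<close>.  By domination \<open>P'\<close> stays in the class, so the infima of \<open>L\<close> and
  \<open>W\<close> coincide, which together with \<open>L \<le> W\<close> makes every minimizer of \<open>W\<close> one of \<open>L\<close>.  For a minimizer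
  \<open>P\<close> of \<open>L\<close> the two bounds force \<open>D(P' \<parallel> P) = 0\<close>, hence \<open>P' = P\<close> and \<open>W (P, Q) \<le> L P\<close>.
\<close>

section \<open>Kullback-Leibler divergence\<close>

text \<open>The Radon-Nikodym derivative is unique only \<open>M\<close>-a.e., but null sets of
  \<open>M\<close> stay null for the density measure, so \<open>h\<close> may replace it under the
  logarithm. Integrability then turns the extended integral into a Bochner integral.\<close>

lemma KL_div_density:
  assumes "sigma_finite_measure M" and [measurable]: "h \<in> borel_measurable M"
    and nonneg: "\<And>x. x \<in> space M \<Longrightarrow> 0 \<le> h x"
    and int: "integrable (density M (\<lambda>x. ennreal (h x))) (\<lambda>x. ln (h x))"
  shows "KL_div (density M (\<lambda>x. ennreal (h x))) M =
           ereal (\<integral>x. ln (h x) \<partial>density M (\<lambda>x. ennreal (h x)))"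
proof -
  let ?N = "density M (\<lambda>x. ennreal (h x))"
  interpret sigma_finite_measure M by fact
  have "AE x in M. ennreal (h x) = RN_deriv M ?N x"
    by (rule RN_deriv_unique) auto
  then have "AE x in M. ln (enn2real (RN_deriv M ?N x)) = ln (h x)"
    using AE_space by eventually_elim (metis enn2real_ennreal nonneg)
  then have eq: "AE x in ?N. ln (enn2real (RN_deriv M ?N x)) = ln (h x)"
    by (subst AE_density) auto
  have int': "integrable ?N (\<lambda>x. ln (enn2real (RN_deriv M ?N x)))"
    by (rule integrable_cong_AE_imp[OF int]) (use eq in \<open>auto elim: AE_mp\<close>)
  have "KL_div ?N M = ereal (\<integral>x. ln (enn2real (RN_deriv M ?N x)) \<partial>?N)"
    unfolding KL_div_def
    by (simp add: absolutely_continuousI_density ext_integral_eq_lebesgue_integral[OF int'])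
  also have "(\<integral>x. ln (enn2real (RN_deriv M ?N x)) \<partial>?N) = (\<integral>x. ln (h x) \<partial>?N)"
    by (rule integral_cong_AE) (use eq in auto)
  finally show ?thesis .
qed

text \<open>Gibbs' inequality. With \<open>D = dN/dM\<close>, integrate
  \<open>ln (k / D) \<le> k / D - 1\<close> against \<open>N\<close>; the right-hand side is at most
  \<open>0\<close> because the \<open>N\<close>-integral of \<open>k / D\<close> is bounded by the
  \<open>M\<close>-integral of \<open>k\<close>.\<close>

lemma KL_div_ge_integral_ln:
  assumes "prob_space M" and "prob_space N" and sets_eq: "sets N = sets M"
    and [measurable]: "k \<in> borel_measurable M"
    and pos: "\<And>x. x \<in> space M \<Longrightarrow> 0 < k x"
    and le1: "(\<integral>\<^sup>+x. ennreal (k x) \<partial>M) \<le> 1"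
    and int: "integrable N (\<lambda>x. ln (k x))"
  shows "ereal (\<integral>x. ln (k x) \<partial>N) \<le> KL_div N M"
proof (cases "absolutely_continuous M N")
  case False
  then show ?thesis by (simp add: KL_div_def)
next
  case ac: True
  interpret M: prob_space M by fact
  interpret N: prob_space N by fact
  obtain D where D[measurable]: "D \<in> borel_measurable M"
    and RN: "AE x in M. RN_deriv M N x = ennreal (D x)"
    and Dpos: "AE x in N. 0 < D x" and Dnn: "\<And>x. 0 \<le> D x"
    using M.real_RN_deriv[OF N.finite_measure_axioms ac sets_eq] by metis
  have [measurable_cong]: "sets N = sets M" by (fact sets_eq)
  have N_eq: "N = density M (\<lambda>x. ennreal (D x))"
  proof -
    have "N = density M (RN_deriv M N)"
      by (rule M.density_RN_deriv[OF ac sets_eq, symmetric])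
    also have "\<dots> = density M (\<lambda>x. ennreal (D x))"
      by (rule density_cong) (use RN in auto)
    finally show ?thesis .
  qed
  have RN_N: "AE x in N. RN_deriv M N x = ennreal (D x)"
    using RN absolutely_continuous_AE[OF sets_eq ac] by blast
  let ?l = "\<lambda>x. ln (enn2real (RN_deriv M N x))"
  have l_eq: "AE x in N. ?l x = ln (D x)"
    using RN_N by eventually_elim (simp add: Dnn)
  have nn_N: "(\<integral>\<^sup>+x. ennreal (g x) \<partial>N) = (\<integral>\<^sup>+x. ennreal (D x * g x) \<partial>M)"
    if [measurable]: "g \<in> borel_measurable M" for g
    by (subst N_eq, subst nn_integral_density) (simp_all add: ennreal_mult' Dnn)
  \<comment> \<open>The negative part is always finite, since \<open>- t * ln t \<le> 1\<close> for
    \<open>t \<ge> 0\<close>. Hence the divergence is either infinite, where the claim is trivial,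
    or an ordinary integral.\<close>
  have neg: "(\<integral>\<^sup>+x. ennreal (- ?l x) \<partial>N) \<le> 1"
  proof -
    have "(\<integral>\<^sup>+x. ennreal (- ?l x) \<partial>N) = (\<integral>\<^sup>+x. ennreal (- ln (D x)) \<partial>N)"
      by (rule nn_integral_cong_AE) (use l_eq in \<open>eventually_elim, simp\<close>)
    also have "\<dots> = (\<integral>\<^sup>+x. ennreal (D x * - ln (D x)) \<partial>M)"
      by (rule nn_N) simp
    also have "\<dots> \<le> (\<integral>\<^sup>+x. 1 \<partial>M)"
    proof (rule nn_integral_mono)
      fix x
      have "D x * - ln (D x) \<le> 1"
      proof (cases "D x = 0")
        case False
        then have "0 < D x" using Dnn[of x] by simp
        then show ?thesis
          using ln_le_minus_one[of "1 / D x"] by (simp add: ln_div field_simps)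
      qed simp
      then show "ennreal (D x * - ln (D x)) \<le> 1"
        by (simp add: ennreal_le_1)
    qed
    finally show ?thesis by (simp add: M.emeasure_space_1)
  qed
  show ?thesis
  proof (cases "(\<integral>\<^sup>+x. ennreal (?l x) \<partial>N) = \<infinity>")
    case True
    have "KL_div N M = \<infinity>"
      using ac neg unfolding KL_div_def ext_integral_def True
      by (cases "\<integral>\<^sup>+x. ennreal (- ?l x) \<partial>N") auto
    then show ?thesis by simp
  next
    case False
    have "(\<integral>\<^sup>+x. ennreal (- ?l x) \<partial>N) \<noteq> \<infinity>"
      using neg by (auto simp: top_unique)
    with False have int_l: "integrable N ?l"
      by (simp add: real_integrable_def)
    have int_lnD: "integrable N (\<lambda>x. ln (D x))"
      by (rule integrable_cong_AE_imp[OF int_l]) (use l_eq in \<open>auto elim: AE_mp\<close>)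
    have "(\<integral>\<^sup>+x. ennreal (k x / D x) \<partial>N) = (\<integral>\<^sup>+x. ennreal (D x * (k x / D x)) \<partial>M)"
      by (rule nn_N) simp
    \<comment> \<open>Only an inequality: where \<open>D x = 0\<close> the left integrand is
      \<open>0\<close>, while \<open>k x\<close> is positive.\<close>
    also have "\<dots> \<le> (\<integral>\<^sup>+x. ennreal (k x) \<partial>M)"
      by (rule nn_integral_mono) (auto intro!: ennreal_leI simp: less_imp_le pos)
    also note le1
    finally have nn_le: "(\<integral>\<^sup>+x. ennreal (k x / D x) \<partial>N) \<le> 1" .
    have q_nn: "AE x in N. 0 \<le> k x / D x"
      using AE_space by eventually_elim
        (simp add: Dnn less_imp_le[OF pos] sets_eq_imp_space_eq[OF sets_eq])
    have int_q: "integrable N (\<lambda>x. k x / D x)"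
      by (rule integrableI_nonneg[OF _ q_nn])
        (use nn_le in \<open>auto simp: less_top[symmetric] top_unique\<close>)
    have q_le: "(\<integral>x. k x / D x \<partial>N) \<le> 1"
      using nn_le by (simp add: nn_integral_eq_integral[OF int_q q_nn] ennreal_le_1)
    have "(\<integral>x. ln (k x) - ln (D x) \<partial>N) \<le> (\<integral>x. k x / D x - 1 \<partial>N)"
    proof (rule integral_mono_AE)
      show "AE x in N. ln (k x) - ln (D x) \<le> k x / D x - 1"
        using Dpos AE_space
      proof eventually_elim
        case (elim x)
        then have "0 < k x" by (simp add: pos sets_eq_imp_space_eq[OF sets_eq])
        with elim show ?case
          using ln_le_minus_one[of "k x / D x"] by (simp add: ln_div)
      qed
    qed (use int int_lnD int_q in auto)
    then have "(\<integral>x. ln (k x) \<partial>N) \<le> (\<integral>x. ln (D x) \<partial>N)"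
      using int int_lnD int_q q_le by (simp add: N.prob_space)
    also have "(\<integral>x. ln (D x) \<partial>N) = (\<integral>x. ?l x \<partial>N)"
      by (rule integral_cong_AE) (use l_eq in auto)
    finally show ?thesis
      using ac by (simp add: KL_div_def ext_integral_eq_lebesgue_integral[OF int_l])
  qed
qed

lemma mult_ln_ge_minus_one:
  fixes t :: real
  assumes "0 < t"
  shows "t - 1 \<le> t * ln t"
  using ln_le_minus_one[of "1 / t"] assms by (simp add: ln_div field_simps)

lemma mult_ln_eq_minus_one_iff:
  fixes t :: real
  assumes "0 < t"
  shows "t * ln t = t - 1 \<longleftrightarrow> t = 1"
proof
  assume "t * ln t = t - 1"
  then have "ln (1 / t) = 1 / t - 1"
    using assms by (simp add: ln_div field_simps)
  then have "1 / t = 1"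
    using assms by (intro ln_eq_minus_one) auto
  then show "t = 1" by simp
qed simp

text \<open>Since \<open>f\<close> has mean \<open>1\<close>, subtracting \<open>f - 1\<close> does
  not change the expectation of \<open>f * ln f\<close>, and it makes the integrand pointwise
  nonnegative with equality only at \<open>f x = 1\<close>. This is nonnegativity of the divergence
  of \<open>f M\<close> from \<open>M\<close>, with its equality case.\<close>

lemma (in prob_space) expectation_mult_ln_nonneg:
  fixes f :: "'a \<Rightarrow> real"
  assumes "integrable M f" and "expectation f = 1" and "\<And>x. 0 < f x"
    and "integrable M (\<lambda>x. f x * ln (f x))"
  shows "0 \<le> expectation (\<lambda>x. f x * ln (f x))"
    and "expectation (\<lambda>x. f x * ln (f x)) = 0 \<Longrightarrow> AE x in M. f x = 1"
proof -
  have nn: "0 \<le> f x * ln (f x) - (f x - 1)" for x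
    using mult_ln_ge_minus_one[OF assms(3)[of x]] by simp
  have int: "integrable M (\<lambda>x. f x * ln (f x) - (f x - 1))"
    using assms by auto
  have eq: "expectation (\<lambda>x. f x * ln (f x) - (f x - 1)) = expectation (\<lambda>x. f x * ln (f x))"
    using assms by (simp add: prob_space)
  show "0 \<le> expectation (\<lambda>x. f x * ln (f x))"
    unfolding eq[symmetric] by (rule Bochner_Integration.integral_nonneg) (rule nn)
  assume "expectation (\<lambda>x. f x * ln (f x)) = 0"
  then have "AE x in M. f x * ln (f x) - (f x - 1) = 0"
    using integral_nonneg_eq_0_iff_AE[OF int] nn eq by simp
  then show "AE x in M. f x = 1"
    by eventually_elim (use mult_ln_eq_minus_one_iff[OF assms(3)] in simp)
qed

section \<open>Marginals and couplings\<close>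

text \<open>Tonelli. Together with its counterpart for \<open>snd\<close>, this identifies the
  marginals of the coupling built from the posterior kernel.\<close>

lemma distr_fst_density:
  assumes "sigma_finite_measure N" and [measurable]: "k \<in> borel_measurable (M \<Otimes>\<^sub>M N)"
  shows "distr (density (M \<Otimes>\<^sub>M N) k) M fst = density M (\<lambda>x. \<integral>\<^sup>+y. k (x, y) \<partial>N)"
proof (rule measure_eqI)
  interpret N: sigma_finite_measure N by fact
  fix A assume "A \<in> sets (distr (density (M \<Otimes>\<^sub>M N) k) M fst)"
  then have A[measurable]: "A \<in> sets M" by simp
  have "emeasure (distr (density (M \<Otimes>\<^sub>M N) k) M fst) A =
      (\<integral>\<^sup>+z. k z * indicator A (fst z) \<partial>(M \<Otimes>\<^sub>M N))"
    by (subst emeasure_distr)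
      (auto simp: emeasure_density intro!: nn_integral_cong split: split_indicator)
  also have "\<dots> = (\<integral>\<^sup>+x. \<integral>\<^sup>+y. k (x, y) * indicator A x \<partial>N \<partial>M)"
    by (subst N.nn_integral_fst[symmetric]) auto
  also have "\<dots> = emeasure (density M (\<lambda>x. \<integral>\<^sup>+y. k (x, y) \<partial>N)) A"
    by (subst emeasure_density) (auto intro!: nn_integral_cong nn_integral_multc)
  finally show "emeasure (distr (density (M \<Otimes>\<^sub>M N) k) M fst) A = \<dots>" .
qed simp

lemma distr_snd_density:
  assumes "sigma_finite_measure M" "sigma_finite_measure N"
    and [measurable]: "k \<in> borel_measurable (M \<Otimes>\<^sub>M N)"
  shows "distr (density (M \<Otimes>\<^sub>M N) k) N snd = density N (\<lambda>y. \<integral>\<^sup>+x. k (x, y) \<partial>M)"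
proof (rule measure_eqI)
  interpret M: sigma_finite_measure M by fact
  interpret N: sigma_finite_measure N by fact
  interpret pair_sigma_finite M N ..
  fix A assume "A \<in> sets (distr (density (M \<Otimes>\<^sub>M N) k) N snd)"
  then have A[measurable]: "A \<in> sets N" by simp
  have "emeasure (distr (density (M \<Otimes>\<^sub>M N) k) N snd) A =
      (\<integral>\<^sup>+z. k z * indicator A (snd z) \<partial>(M \<Otimes>\<^sub>M N))"
    by (subst emeasure_distr)
      (auto simp: emeasure_density intro!: nn_integral_cong split: split_indicator)
  also have "\<dots> = (\<integral>\<^sup>+y. \<integral>\<^sup>+x. k (x, y) * indicator A y \<partial>M \<partial>N)"
    by (subst nn_integral_snd[symmetric]) auto
  also have "\<dots> = emeasure (density N (\<lambda>y. \<integral>\<^sup>+x. k (x, y) \<partial>M)) A"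
    by (subst emeasure_density) (auto intro!: nn_integral_cong nn_integral_multc)
  finally show "emeasure (distr (density (M \<Otimes>\<^sub>M N) k) N snd) A = \<dots>" .
qed simp

text \<open>Terms that depend on one coordinate integrate to the same value under every coupling. In
  the logarithm of the posterior kernel, this leaves the quadratic cost as the only term that
  depends on the coupling.\<close>

lemma couplings_integral_fst:
  fixes f :: "'a::topological_space \<Rightarrow> real"
  assumes "\<gamma> \<in> couplings \<mu> \<nu>" and "integrable \<mu> f"
  shows "integrable \<gamma> (\<lambda>z. f (fst z))" and "(\<integral>z. f (fst z) \<partial>\<gamma>) = (\<integral>x. f x \<partial>\<mu>)"
proof -
  have [measurable_cong]: "sets \<gamma> = sets (borel \<Otimes>\<^sub>M borel)" and \<mu>: "\<mu> = distr \<gamma> borel fst"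
    using assms(1) by (auto simp: couplings_def)
  have [measurable]: "f \<in> borel_measurable borel"
    using assms(2) unfolding \<mu> by (auto dest: borel_measurable_integrable)
  show "integrable \<gamma> (\<lambda>z. f (fst z))"
    using assms(2) unfolding \<mu> by (subst (asm) integrable_distr_eq) auto
  show "(\<integral>z. f (fst z) \<partial>\<gamma>) = (\<integral>x. f x \<partial>\<mu>)"
    unfolding \<mu> by (subst integral_distr) auto
qed

lemma couplings_integral_snd:
  fixes f :: "'b::topological_space \<Rightarrow> real"
  assumes "\<gamma> \<in> couplings \<mu> \<nu>" and "integrable \<nu> f"
  shows "integrable \<gamma> (\<lambda>z. f (snd z))" and "(\<integral>z. f (snd z) \<partial>\<gamma>) = (\<integral>x. f x \<partial>\<nu>)"
proof -
  have [measurable_cong]: "sets \<gamma> = sets (borel \<Otimes>\<^sub>M borel)" and \<nu>: "\<nu> = distr \<gamma> borel snd"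
    using assms(1) by (auto simp: couplings_def)
  have [measurable]: "f \<in> borel_measurable borel"
    using assms(2) unfolding \<nu> by (auto dest: borel_measurable_integrable)
  show "integrable \<gamma> (\<lambda>z. f (snd z))"
    using assms(2) unfolding \<nu> by (subst (asm) integrable_distr_eq) auto
  show "(\<integral>z. f (snd z) \<partial>\<gamma>) = (\<integral>x. f x \<partial>\<nu>)"
    unfolding \<nu> by (subst integral_distr) auto
qed

text \<open>Finite second moments of the marginals make the transport cost finite for every
  coupling, by \<open>(norm (a - b))\<^sup>2 \<le> 2 * (norm a)\<^sup>2 + 2 * (norm
  b)\<^sup>2\<close>.\<close>

lemma couplings_integrable_dist_sq:
  fixes \<mu> \<nu> :: "(real ^ 'd) measure"
  assumes \<gamma>: "\<gamma> \<in> couplings \<mu> \<nu>"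
    and "integrable \<mu> (\<lambda>x. (norm x)\<^sup>2)" "integrable \<nu> (\<lambda>x. (norm x)\<^sup>2)"
  shows "integrable \<gamma> (\<lambda>z. (norm (fst z - snd z))\<^sup>2)"
proof (rule Bochner_Integration.integrable_bound)
  have [measurable_cong]: "sets \<gamma> = sets (borel \<Otimes>\<^sub>M borel)"
    using \<gamma> by (auto simp: couplings_def)
  show "integrable \<gamma> (\<lambda>z. 2 * (norm (fst z))\<^sup>2 + 2 * (norm (snd z))\<^sup>2)"
    using couplings_integral_fst(1)[OF \<gamma> assms(2)] couplings_integral_snd(1)[OF \<gamma> assms(3)] by simp
  show "(\<lambda>z. (norm (fst z - snd z))\<^sup>2) \<in> borel_measurable \<gamma>" by measurable
  have "(norm (a - b))\<^sup>2 \<le> 2 * (norm a)\<^sup>2 + 2 * (norm b)\<^sup>2" for a b :: "real ^ 'd"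
  proof -
    have "(norm (a - b))\<^sup>2 \<le> (norm a + norm b)\<^sup>2"
      by (intro power_mono norm_triangle_ineq4) simp
    also have "\<dots> \<le> 2 * (norm a)\<^sup>2 + 2 * (norm b)\<^sup>2"
      using sum_squares_bound[of "norm a" "norm b"] by (simp add: power2_sum)
    finally show ?thesis .
  qed
  then show "AE z in \<gamma>. norm ((norm (fst z - snd z))\<^sup>2) \<le> norm (2 * (norm (fst z))\<^sup>2 + 2 * (norm (snd z))\<^sup>2)"
    by (intro AE_I2) simp
qed

section \<open>The empirical measure\<close>

lemma prob_space_empirical_measure:
  assumes "n \<ge> 1"
  shows "prob_space (empirical_measure n y)"
proof -
  interpret prob_space "uniform_count_measure {1..n}"
    using assms by (intro prob_space_uniform_count_measure) auto
  show ?thesis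
    unfolding empirical_measure_def by (intro prob_space_distr) (simp add: measurable_def)
qed

lemma sets_empirical_measure [measurable_cong, simp]: "sets (empirical_measure n y) = sets borel"
  by (simp add: empirical_measure_def)

lemma
  fixes f :: "'a::topological_space \<Rightarrow> real"
  assumes [measurable]: "f \<in> borel_measurable borel"
  shows integrable_empirical_measure: "integrable (empirical_measure n y) f"
    and integral_empirical_measure:
      "(\<integral>x. f x \<partial>empirical_measure n y) = (\<Sum>i=1..n. f (y i)) / real n"
proof -
  have y: "y \<in> measurable (uniform_count_measure {1..n}) borel"
    by (simp add: measurable_def)
  show "integrable (empirical_measure n y) f"
    unfolding empirical_measure_def
    by (subst integrable_distr_eq[OF y])
      (simp_all add: uniform_count_measure_def integrable_point_measure_finite)
  show "(\<integral>x. f x \<partial>empirical_measure n y) = (\<Sum>i=1..n. f (y i)) / real n"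
    unfolding empirical_measure_def
    by (subst integral_distr[OF y])
      (simp_all add: uniform_count_measure_def lebesgue_integral_point_measure_finite
        sum_divide_distrib)
qed

section \<open>Gaussian densities\<close>

lemma gauss_density_pos: "\<sigma> > 0 \<Longrightarrow> 0 < gauss_density \<sigma> x"
  by (simp add: gauss_density_def)

lemma gauss_density_le:
  "\<sigma> > 0 \<Longrightarrow> gauss_density \<sigma> (x :: real ^ 'd) \<le> 1 / sqrt (2 * pi * \<sigma>\<^sup>2) ^ CARD('d)"
  unfolding gauss_density_def by (intro divide_right_mono) simp_all

lemma ln_gauss_density:
  "\<sigma> > 0 \<Longrightarrow> ln (gauss_density \<sigma> (x :: real ^ 'd)) =
     - (norm x)\<^sup>2 / (2 * \<sigma>\<^sup>2) - ln (sqrt (2 * pi * \<sigma>\<^sup>2) ^ CARD('d))"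
  unfolding gauss_density_def by (subst ln_div) simp_all

lemma borel_measurable_gauss_density [measurable]: "gauss_density \<sigma> \<in> borel_measurable borel"
  unfolding gauss_density_def[abs_def] by measurable

lemma integrable_gauss_density:
  assumes "\<sigma> > 0" "finite_measure P" and [measurable_cong]: "sets P = sets borel"
  shows "integrable P (\<lambda>x. gauss_density \<sigma> ((y :: real ^ 'd) - x))"
proof -
  interpret finite_measure P by fact
  show ?thesis
    using gauss_density_le[OF assms(1), where 'd='d] gauss_density_pos[OF assms(1), where 'a='d]
    by (intro integrable_const_bound[of _ "1 / sqrt (2 * pi * \<sigma>\<^sup>2) ^ CARD('d)"])
      (auto simp: abs_of_pos)
qed

text \<open>A vanishing integral of a nonnegative function would force the Gaussian density to be
  zero almost everywhere. Positivity makes the quotients and logarithms below genuine, free of the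
  default values at \<open>0\<close>.\<close>

lemma gauss_conv_pos:
  assumes "\<sigma> > 0" "prob_space P" "sets P = sets borel"
  shows "0 < gauss_conv \<sigma> P (y :: real ^ 'd)"
proof -
  interpret prob_space P by fact
  have "0 \<le> gauss_conv \<sigma> P y"
    unfolding gauss_conv_def by (rule Bochner_Integration.integral_nonneg) (intro less_imp_le gauss_density_pos assms)
  moreover have "gauss_conv \<sigma> P y \<noteq> 0"
  proof
    assume "gauss_conv \<sigma> P y = 0"
    then have "AE x in P. gauss_density \<sigma> (y - x) = 0"
      unfolding gauss_conv_def
      by (subst (asm) integral_nonneg_eq_0_iff_AE)
        (auto intro!: integrable_gauss_density assms less_imp_le gauss_density_pos
          finite_measure_axioms)
    then have "AE x in P. False"
      by eventually_elim (use gauss_density_pos[OF assms(1)] in \<open>auto simp: less_le\<close>)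
    then show False by simp
  qed
  ultimately show ?thesis by simp
qed

lemma borel_measurable_gauss_conv:
  assumes "prob_space P" and [measurable_cong]: "sets P = sets borel"
  shows "gauss_conv \<sigma> P \<in> borel_measurable borel"
proof -
  interpret prob_space P by fact
  show ?thesis unfolding gauss_conv_def[abs_def] by measurable
qed

section \<open>The two bounds on the entropic cost\<close>

text \<open>Bayes' formula: for fixed \<open>snd z\<close> this is the density with respect to the
  prior \<open>P\<close> of the law of \<open>X\<close> given \<open>Y = snd z\<close>.\<close>

definition posterior_kernel ::
    "real \<Rightarrow> (real ^ 'd) measure \<Rightarrow> (real ^ 'd) \<times> (real ^ 'd) \<Rightarrow> real" where
  "posterior_kernel \<sigma> P z = gauss_density \<sigma> (snd z - fst z) / gauss_conv \<sigma> P (snd z)"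

text \<open>The posterior densities averaged over the data: the density with respect to
  \<open>P\<close> of one EM step started at \<open>P\<close>.\<close>

definition em_density ::
    "real \<Rightarrow> nat \<Rightarrow> (nat \<Rightarrow> real ^ 'd) \<Rightarrow> (real ^ 'd) measure \<Rightarrow> real ^ 'd \<Rightarrow> real" where
  "em_density \<sigma> n y P x = (\<Sum>i=1..n. posterior_kernel \<sigma> P (x, y i)) / real n"

text \<open>
  The negative log-likelihood in the normalization of the entropic cost: the additive constant
  turns the density \<open>\<phi>\<^sub>\<sigma>\<close> into the Gibbs weight \<open>exp (- \<parallel>x - y\<parallel>\<^sup>2 / (2 \<sigma>\<^sup>2))\<close>.
\<close>

definition scaled_nll ::
    "real \<Rightarrow> nat \<Rightarrow> (nat \<Rightarrow> real ^ 'd) \<Rightarrow> (real ^ 'd) measure \<Rightarrow> real" where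
  "scaled_nll \<sigma> n y P =
     - \<sigma>\<^sup>2 * (log_likelihood \<sigma> n y P / real n + ln (sqrt (2 * pi * \<sigma>\<^sup>2) ^ CARD('d)))"

section \<open>Posterior kernel and EM density of a fixed prior \<open>P\<close>\<close>

context
  fixes P :: "(real ^ 'd) measure" and \<sigma> :: real and n :: nat and y :: "nat \<Rightarrow> real ^ 'd"
  assumes \<sigma>: "\<sigma> > 0" and n: "n \<ge> 1" and P: "prob_space P"
    and sets_P [measurable_cong]: "sets P = sets borel"
    and moment: "integrable P (\<lambda>x. (norm x)\<^sup>2)"
begin

interpretation prob_space P by (fact P)

interpretation Q: prob_space "empirical_measure n y"
  by (rule prob_space_empirical_measure[OF n])

interpretation PQ: pair_prob_space P "empirical_measure n y" ..

private lemma borel_measurable_conv [measurable]: "gauss_conv \<sigma> P \<in> borel_measurable borel"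
  by (rule borel_measurable_gauss_conv[OF P sets_P])

private lemma conv_pos: "0 < gauss_conv \<sigma> P a"
  by (rule gauss_conv_pos[OF \<sigma> P sets_P])

lemma posterior_kernel_pos: "0 < posterior_kernel \<sigma> P z"
  by (simp add: posterior_kernel_def gauss_density_pos[OF \<sigma>] conv_pos)

lemma borel_measurable_posterior_kernel [measurable]:
  "posterior_kernel \<sigma> P \<in> borel_measurable (borel \<Otimes>\<^sub>M borel)"
  unfolding posterior_kernel_def[abs_def] by measurable

lemma integrable_posterior_kernel: "integrable P (\<lambda>x. posterior_kernel \<sigma> P (x, a))"
  unfolding posterior_kernel_def
  using integrable_gauss_density[OF \<sigma> finite_measure_axioms sets_P] by simp

lemma integral_posterior_kernel: "(\<integral>x. posterior_kernel \<sigma> P (x, a) \<partial>P) = 1"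
  using conv_pos[of a] unfolding posterior_kernel_def by (simp flip: gauss_conv_def)

lemma nn_integral_posterior_kernel:
  "(\<integral>\<^sup>+x. ennreal (posterior_kernel \<sigma> P (x, a)) \<partial>P) = 1"
  by (subst nn_integral_eq_integral[OF integrable_posterior_kernel])
    (simp_all add: integral_posterior_kernel less_imp_le posterior_kernel_pos)

lemma nn_integral_posterior_kernel_empirical:
  "(\<integral>\<^sup>+b. ennreal (posterior_kernel \<sigma> P (x, b)) \<partial>empirical_measure n y) =
     ennreal (em_density \<sigma> n y P x)"
proof -
  have [measurable]: "(\<lambda>b. posterior_kernel \<sigma> P (x, b)) \<in> borel_measurable borel"
    by measurable
  show ?thesis
    by (subst nn_integral_eq_integral)
      (auto simp: integrable_empirical_measure integral_empirical_measure em_density_def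
        less_imp_le posterior_kernel_pos)
qed

lemma em_density_pos: "0 < em_density \<sigma> n y P x"
  using n by (auto simp: em_density_def intro!: divide_pos_pos sum_pos posterior_kernel_pos)

lemma borel_measurable_em_density [measurable]: "em_density \<sigma> n y P \<in> borel_measurable borel"
  unfolding em_density_def[abs_def] by measurable

text \<open>The Gaussian density is bounded, and the denominators are positive and involve only the
  finitely many data points, so the bound is uniform in \<open>x\<close>.\<close>

lemma em_density_bounded: "\<exists>B. \<forall>x. em_density \<sigma> n y P x \<le> B"
proof (intro exI allI)
  fix x
  have "posterior_kernel \<sigma> P (x, a) \<le> 1 / sqrt (2 * pi * \<sigma>\<^sup>2) ^ CARD('d) / gauss_conv \<sigma> P a" for a
    unfolding posterior_kernel_def fst_conv snd_conv
    using conv_pos[of a] by (intro divide_right_mono gauss_density_le \<sigma>) simp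
  then show "em_density \<sigma> n y P x \<le>
      (\<Sum>i=1..n. 1 / sqrt (2 * pi * \<sigma>\<^sup>2) ^ CARD('d) / gauss_conv \<sigma> P (y i)) / real n"
    unfolding em_density_def by (intro divide_right_mono sum_mono) auto
qed

lemma integrable_em_density: "integrable P (em_density \<sigma> n y P)"
  unfolding em_density_def[abs_def] by (simp add: integrable_posterior_kernel)

lemma integral_em_density: "(\<integral>x. em_density \<sigma> n y P x \<partial>P) = 1"
  unfolding em_density_def using n
  by (simp add: integrable_posterior_kernel integral_posterior_kernel)

text \<open>On \<open>0 < t \<le> B\<close> the function \<open>t * ln t\<close> lies between
  \<open>- 1\<close> and \<open>B\<^sup>2\<close>, so the integrand is bounded.\<close>

lemma integrable_em_density_ln:
  "integrable P (\<lambda>x. em_density \<sigma> n y P x * ln (em_density \<sigma> n y P x))"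
proof -
  obtain B where B: "\<And>x. em_density \<sigma> n y P x \<le> B" using em_density_bounded by blast
  have "\<bar>t * ln t\<bar> \<le> 1 + B\<^sup>2" if "0 < t" "t \<le> B" for t :: real
  proof -
    have "t * ln t \<le> t * (t - 1)"
      using that by (intro mult_left_mono ln_le_minus_one) auto
    also have "\<dots> \<le> t\<^sup>2"
      using that by (simp add: power2_eq_square algebra_simps)
    also have "\<dots> \<le> B\<^sup>2"
      using that by (intro power_mono) auto
    finally have "t * ln t \<le> B\<^sup>2" .
    moreover have "- 1 \<le> t * ln t"
      using mult_ln_ge_minus_one[of t] that by simp
    ultimately show ?thesis
      by (smt (verit) zero_le_power2)
  qed
  then show ?thesis
    using B em_density_pos by (intro integrable_const_bound[of _ "1 + B\<^sup>2"]) auto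
qed

text \<open>The logarithm of the kernel splits into the quadratic cost, the normalizing constant,
  and \<open>ln (gauss_conv \<sigma> P)\<close> at the second coordinate, which averages to the
  log-likelihood because the second marginal is empirical. The first marginal \<open>R\<close> is
  kept general: the lower bound takes \<open>R = P\<close>, the upper bound takes the EM
  update.\<close>

lemma coupling_integral_ln_posterior_kernel:
  fixes R :: "(real ^ 'd) measure"
  assumes \<gamma>: "\<gamma> \<in> couplings R (empirical_measure n y)"
    and R: "integrable R (\<lambda>x. (norm x)\<^sup>2)"
  defines "C \<equiv> \<integral>z. (norm (fst z - snd z))\<^sup>2 \<partial>\<gamma>"
  shows "integrable \<gamma> (\<lambda>z. ln (posterior_kernel \<sigma> P z))"
    and "\<sigma>\<^sup>2 * (\<integral>z. ln (posterior_kernel \<sigma> P z) \<partial>\<gamma>) = scaled_nll \<sigma> n y P - C / 2"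
    and "(\<integral>\<^sup>+(x, b). ennreal ((norm (x - b))\<^sup>2 / 2) \<partial>\<gamma>) = ennreal (C / 2)"
    and "0 \<le> C"
proof -
  interpret G: prob_space \<gamma> using \<gamma> by (simp add: couplings_def)
  let ?K = "sqrt (2 * pi * \<sigma>\<^sup>2) ^ CARD('d)"
  have int_sq: "integrable \<gamma> (\<lambda>z. (norm (fst z - snd z))\<^sup>2)"
    by (rule couplings_integrable_dist_sq[OF \<gamma> R]) (simp add: integrable_empirical_measure)
  have ln_meas: "(\<lambda>b. ln (gauss_conv \<sigma> P b)) \<in> borel_measurable borel" by measurable
  note int_ln = couplings_integral_snd[OF \<gamma> integrable_empirical_measure[OF ln_meas]]
  have ln_eq: "ln (posterior_kernel \<sigma> P z) =
      - (norm (fst z - snd z))\<^sup>2 / (2 * \<sigma>\<^sup>2) - ln ?K - ln (gauss_conv \<sigma> P (snd z))" for z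
    using gauss_density_pos[OF \<sigma>, of "snd z - fst z"] conv_pos[of "snd z"]
    by (simp add: posterior_kernel_def ln_div ln_gauss_density[OF \<sigma>] norm_minus_commute)
  show "integrable \<gamma> (\<lambda>z. ln (posterior_kernel \<sigma> P z))"
    unfolding ln_eq using int_sq int_ln(1) by simp
  have "(\<integral>z. ln (posterior_kernel \<sigma> P z) \<partial>\<gamma>) =
      - C / (2 * \<sigma>\<^sup>2) - ln ?K - log_likelihood \<sigma> n y P / real n"
    unfolding ln_eq using int_sq int_ln
    by (simp add: G.prob_space C_def integral_empirical_measure[OF ln_meas] log_likelihood_def)
  then show "\<sigma>\<^sup>2 * (\<integral>z. ln (posterior_kernel \<sigma> P z) \<partial>\<gamma>) = scaled_nll \<sigma> n y P - C / 2"
    using \<sigma> by (simp add: scaled_nll_def field_simps)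
  show "(\<integral>\<^sup>+(x, b). ennreal ((norm (x - b))\<^sup>2 / 2) \<partial>\<gamma>) = ennreal (C / 2)"
    unfolding case_prod_unfold C_def
    using int_sq by (subst nn_integral_eq_integral) auto
  show "0 \<le> C" by (simp add: C_def)
qed

text \<open>The kernel has mass \<open>1\<close> under the product of the marginals, so Gibbs'
  inequality bounds the mutual information of any coupling below by the integral of its logarithm.
  Adding the cost cancels the quadratic term.\<close>

lemma entropic_OT_ge_scaled_nll:
  "ereal (scaled_nll \<sigma> n y P) \<le> entropic_OT (\<sigma>\<^sup>2) P (empirical_measure n y)"
  unfolding entropic_OT_def
proof (rule INF_greatest)
  let ?Q = "empirical_measure n y"
  fix \<gamma> assume \<gamma>: "\<gamma> \<in> couplings P ?Q"
  note C = coupling_integral_ln_posterior_kernel[OF \<gamma> moment]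
  define C where "C = (\<integral>z. (norm (fst z - snd z))\<^sup>2 \<partial>\<gamma>)"
  define I where "I = (\<integral>z. ln (posterior_kernel \<sigma> P z) \<partial>\<gamma>)"
  have "ereal I \<le> KL_div \<gamma> (P \<Otimes>\<^sub>M ?Q)"
    unfolding I_def
  proof (rule KL_div_ge_integral_ln[OF PQ.prob_space_axioms])
    show "prob_space \<gamma>" "sets \<gamma> = sets (P \<Otimes>\<^sub>M ?Q)"
      using \<gamma> by (auto simp: couplings_def intro!: sets_pair_measure_cong sets_P)
    have "(\<integral>\<^sup>+z. ennreal (posterior_kernel \<sigma> P z) \<partial>(P \<Otimes>\<^sub>M ?Q)) =
        (\<integral>\<^sup>+b. \<integral>\<^sup>+x. ennreal (posterior_kernel \<sigma> P (x, b)) \<partial>P \<partial>?Q)"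
      by (subst PQ.nn_integral_snd[symmetric]) auto
    also have "\<dots> = 1"
      by (simp add: nn_integral_posterior_kernel Q.emeasure_space_1)
    finally show "(\<integral>\<^sup>+z. ennreal (posterior_kernel \<sigma> P z) \<partial>(P \<Otimes>\<^sub>M ?Q)) \<le> 1" by simp
  qed (auto simp: posterior_kernel_pos C(1))
  then have "ereal I \<le> mutual_info \<gamma>"
    using \<gamma> by (simp add: mutual_info_def couplings_def)
  then have "ereal (C / 2) + ereal (\<sigma>\<^sup>2) * ereal I \<le> ereal (C / 2) + ereal (\<sigma>\<^sup>2) * mutual_info \<gamma>"
    by (intro add_left_mono ereal_mult_left_mono) auto
  moreover have "C / 2 + \<sigma>\<^sup>2 * I = scaled_nll \<sigma> n y P"
    using C(2) by (simp add: C_def I_def)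
  ultimately show "ereal (scaled_nll \<sigma> n y P) \<le>
      enn2ereal (\<integral>\<^sup>+(x, y). ennreal ((norm (x - y))\<^sup>2 / 2) \<partial>\<gamma>) + ereal (\<sigma>\<^sup>2) * mutual_info \<gamma>"
    unfolding C(3) C_def[symmetric] using C(4) by (simp add: C_def enn2ereal_ennreal)
qed

section \<open>The EM update and its entropic cost\<close>

lemma prob_space_em_update: "prob_space (density P (\<lambda>x. ennreal (em_density \<sigma> n y P x)))"
proof (rule prob_spaceI)
  have "(\<integral>\<^sup>+x. ennreal (em_density \<sigma> n y P x) \<partial>P) = 1"
    by (subst nn_integral_eq_integral[OF integrable_em_density])
      (simp_all add: integral_em_density less_imp_le em_density_pos)
  then show "emeasure (density P (\<lambda>x. ennreal (em_density \<sigma> n y P x)))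
      (space (density P (\<lambda>x. ennreal (em_density \<sigma> n y P x)))) = 1"
    by (subst emeasure_density) (auto cong: nn_integral_cong_simp)
qed

text \<open>A bounded density preserves finiteness of the second moment; this makes the preceding
  coupling computation available with the update as first marginal.\<close>

lemma integrable_norm_sq_em_update:
  "integrable (density P (\<lambda>x. ennreal (em_density \<sigma> n y P x))) (\<lambda>x. (norm x)\<^sup>2)"
proof -
  obtain B where B: "\<And>x. em_density \<sigma> n y P x \<le> B" using em_density_bounded by blast
  have "integrable P (\<lambda>x. em_density \<sigma> n y P x * (norm x)\<^sup>2)"
  proof (rule Bochner_Integration.integrable_bound)
    show "integrable P (\<lambda>x. B * (norm x)\<^sup>2)" using moment by simp
    have "\<bar>em_density \<sigma> n y P x\<bar> * (norm x)\<^sup>2 \<le> \<bar>B\<bar> * (norm x)\<^sup>2" for x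
      using B[of x] em_density_pos[of x] by (intro mult_right_mono) auto
    then show "AE x in P. norm (em_density \<sigma> n y P x * (norm x)\<^sup>2) \<le> norm (B * (norm x)\<^sup>2)"
      by (simp add: abs_mult)
  qed measurable
  then show ?thesis
    by (subst integrable_density) (auto simp: less_imp_le em_density_pos)
qed

lemma entropic_OT_em_update_le:
  "entropic_OT (\<sigma>\<^sup>2) (density P (\<lambda>x. ennreal (em_density \<sigma> n y P x))) (empirical_measure n y)
     \<le> ereal (scaled_nll \<sigma> n y P
         - \<sigma>\<^sup>2 * (\<integral>x. em_density \<sigma> n y P x * ln (em_density \<sigma> n y P x) \<partial>P))"
proof -
  let ?Q = "empirical_measure n y"
  let ?f = "em_density \<sigma> n y P"
  let ?k = "posterior_kernel \<sigma> P"
  let ?P' = "density P (\<lambda>x. ennreal (?f x))"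
  define \<gamma> where "\<gamma> = density (P \<Otimes>\<^sub>M ?Q) (\<lambda>z. ennreal (?k z))"
  have sets_PQ: "sets (P \<Otimes>\<^sub>M ?Q) = sets (borel \<Otimes>\<^sub>M borel)"
    by (intro sets_pair_measure_cong sets_P) simp
  have "distr \<gamma> borel fst = distr \<gamma> P fst"
    by (rule distr_cong) (auto simp: sets_P)
  also have "\<dots> = ?P'"
    unfolding \<gamma>_def
    by (subst distr_fst_density)
      (auto simp: nn_integral_posterior_kernel_empirical Q.sigma_finite_measure_axioms)
  finally have fst_\<gamma>: "distr \<gamma> borel fst = ?P'" .
  have "distr \<gamma> borel snd = distr \<gamma> ?Q snd"
    by (rule distr_cong) auto
  also have "\<dots> = ?Q"
    unfolding \<gamma>_def
    by (subst distr_snd_density)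
      (auto simp: nn_integral_posterior_kernel Q.sigma_finite_measure_axioms
        sigma_finite_measure_axioms density_1)
  finally have snd_\<gamma>: "distr \<gamma> borel snd = ?Q" .
  \<comment> \<open>The total mass is read off from the second marginal, which is already known to
    be a probability measure.\<close>
  have "prob_space \<gamma>"
  proof -
    have "prob_space (distr \<gamma> borel snd)"
      unfolding snd_\<gamma> by (rule Q.prob_space_axioms)
    then show ?thesis
      by (rule prob_space_distrD[rotated]) (simp add: \<gamma>_def)
  qed
  then have \<gamma>: "\<gamma> \<in> couplings ?P' ?Q"
    unfolding couplings_def using fst_\<gamma> snd_\<gamma> by (simp add: \<gamma>_def sets_PQ del: sets_empirical_measure)
  note C = coupling_integral_ln_posterior_kernel[OF \<gamma> integrable_norm_sq_em_update]
  define C where "C = (\<integral>z. (norm (fst z - snd z))\<^sup>2 \<partial>\<gamma>)"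
  \<comment> \<open>The density of \<open>\<gamma>\<close> with respect to the product of its own
    marginals: \<open>?k\<close> is relative to \<open>P \<Otimes>\<^sub>M ?Q\<close>, and passing
    from \<open>P\<close> to \<open>?P'\<close> divides by \<open>?f\<close>. This quotient produces
    the gain \<open>- \<sigma>\<^sup>2 * (\<integral>x. ?f x * ln (?f x)
    \<partial>P)\<close>.\<close>
  define h where "h z = ?k z / ?f (fst z)" for z
  have [measurable]: "h \<in> borel_measurable (borel \<Otimes>\<^sub>M borel)"
    unfolding h_def[abs_def] by measurable
  have ln_h: "ln (h z) = ln (?k z) - ln (?f (fst z))" for z
    unfolding h_def using posterior_kernel_pos[of z] em_density_pos[of "fst z"] by (simp add: ln_div)
  have int_f: "integrable ?P' (\<lambda>x. ln (?f x))"
    "(\<integral>x. ln (?f x) \<partial>?P') = (\<integral>x. ?f x * ln (?f x) \<partial>P)"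
    using integrable_em_density_ln
    by (auto simp: integrable_density integral_density less_imp_le em_density_pos)
  note int_f' = couplings_integral_fst[OF \<gamma> int_f(1)]
  \<comment> \<open>The trivial density \<open>1\<close> on \<open>?Q\<close> brings the product
    into the form required by \<open>pair_measure_density\<close>.\<close>
  have "?P' \<Otimes>\<^sub>M ?Q = ?P' \<Otimes>\<^sub>M density ?Q (\<lambda>_. 1)"
    by (simp add: density_1)
  also have "\<dots> = density (P \<Otimes>\<^sub>M ?Q) (\<lambda>(x, b). ennreal (?f x) * 1)"
    by (rule pair_measure_density) (auto simp: density_1 Q.sigma_finite_measure_axioms)
  finally have prod_eq: "?P' \<Otimes>\<^sub>M ?Q = density (P \<Otimes>\<^sub>M ?Q) (\<lambda>z. ennreal (?f (fst z)))"
    by (simp add: case_prod_unfold)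
  have "density (?P' \<Otimes>\<^sub>M ?Q) (\<lambda>z. ennreal (h z)) =
      density (P \<Otimes>\<^sub>M ?Q) (\<lambda>z. ennreal (?f (fst z)) * ennreal (h z))"
    unfolding prod_eq by (rule density_density_eq) auto
  also have "(\<lambda>z. ennreal (?f (fst z)) * ennreal (h z)) = (\<lambda>z. ennreal (?k z))"
    using em_density_pos
    by (auto simp: fun_eq_iff h_def less_imp_le less_imp_neq[symmetric] posterior_kernel_pos
        simp flip: ennreal_mult)
  finally have \<gamma>_eq: "density (?P' \<Otimes>\<^sub>M ?Q) (\<lambda>z. ennreal (h z)) = \<gamma>"
    by (simp add: \<gamma>_def)
  interpret P': prob_space ?P' by (rule prob_space_em_update)
  interpret P'Q: pair_prob_space ?P' ?Q ..
  have int_h: "integrable \<gamma> (\<lambda>z. ln (h z))"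
    unfolding ln_h using C(1) int_f'(1) by simp
  have "mutual_info \<gamma> = ereal (\<integral>z. ln (h z) \<partial>\<gamma>)"
    unfolding mutual_info_def fst_\<gamma> snd_\<gamma>
    using KL_div_density[OF P'Q.sigma_finite_measure_axioms, of h, unfolded \<gamma>_eq, OF _ _ int_h]
    by (simp add: h_def less_imp_le posterior_kernel_pos em_density_pos)
  also have "(\<integral>z. ln (h z) \<partial>\<gamma>) = (\<integral>z. ln (?k z) \<partial>\<gamma>) - (\<integral>x. ?f x * ln (?f x) \<partial>P)"
    unfolding ln_h using C(1) int_f' int_f(2) by simp
  finally have "enn2ereal (\<integral>\<^sup>+(x, b). ennreal ((norm (x - b))\<^sup>2 / 2) \<partial>\<gamma>) + ereal (\<sigma>\<^sup>2) * mutual_info \<gamma>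
      = ereal (C / 2 + \<sigma>\<^sup>2 * ((\<integral>z. ln (?k z) \<partial>\<gamma>) - (\<integral>x. ?f x * ln (?f x) \<partial>P)))"
    unfolding C(3) C_def[symmetric] using C(4) by (simp add: C_def enn2ereal_ennreal)
  also have "C / 2 + \<sigma>\<^sup>2 * ((\<integral>z. ln (?k z) \<partial>\<gamma>) - (\<integral>x. ?f x * ln (?f x) \<partial>P)) =
      scaled_nll \<sigma> n y P - \<sigma>\<^sup>2 * (\<integral>x. ?f x * ln (?f x) \<partial>P)"
    using C(2) by (simp add: C_def right_diff_distrib)
  finally show ?thesis
    unfolding entropic_OT_def by (intro INF_lower2[OF \<gamma>]) simp
qed

end

section \<open>From the two bounds to the equivalence of optimizers\<close>

lemma log_likelihood_le_iff_scaled_nll_le: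
  assumes "n \<ge> 1" "\<sigma> > 0"
  shows "log_likelihood \<sigma> n y P \<le> log_likelihood \<sigma> n y R \<longleftrightarrow>
           scaled_nll \<sigma> n y R \<le> scaled_nll \<sigma> n y P"
  using assms by (simp add: scaled_nll_def divide_le_cancel)

theorem theorem1:
  fixes \<P> :: "(real ^ 'd) measure set" and y :: "nat \<Rightarrow> real ^ 'd" and n :: nat and \<sigma> :: real
    and Phat :: "(real ^ 'd) measure"
  assumes "n \<ge> 1" and "\<sigma> > 0"
    and "\<And>P. P \<in> \<P> \<Longrightarrow> prob_space P \<and> sets P = sets borel \<and> integrable P (\<lambda>x. (norm x)\<^sup>2)"
    and "closed_under_domination \<P>"
  shows "is_arg_max (log_likelihood \<sigma> n y) (\<lambda>P. P \<in> \<P>) Phat \<longleftrightarrow>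
         is_arg_min (\<lambda>P. entropic_OT (\<sigma>\<^sup>2) P (empirical_measure n y)) (\<lambda>P. P \<in> \<P>) Phat"
proof -
  let ?W = "\<lambda>P. entropic_OT (\<sigma>\<^sup>2) P (empirical_measure n y)"
  let ?L = "scaled_nll \<sigma> n y"
  let ?f = "em_density \<sigma> n y"
  let ?T = "\<lambda>P. density P (\<lambda>x. ennreal (?f P x))"
  let ?D = "\<lambda>P. \<integral>x. ?f P x * ln (?f P x) \<partial>P"
  have P: "prob_space P" "sets P = sets borel" "integrable P (\<lambda>x. (norm x)\<^sup>2)" if "P \<in> \<P>" for P
    using assms(3)[OF that] by auto
  have lower: "ereal (?L P) \<le> ?W P" if "P \<in> \<P>" for P
    by (rule entropic_OT_ge_scaled_nll[OF assms(2,1) P[OF that]])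
  have upper: "?W (?T P) \<le> ereal (?L P - \<sigma>\<^sup>2 * ?D P)" if "P \<in> \<P>" for P
    by (rule entropic_OT_em_update_le[OF assms(2,1) P[OF that]])
  have T: "?T P \<in> \<P>" if "P \<in> \<P>" for P
  proof -
    have [measurable_cong]: "sets P = sets borel" by (rule P[OF that])
    have [measurable]: "?f P \<in> borel_measurable borel"
      by (rule borel_measurable_em_density[OF assms(2,1) P[OF that]])
    have "absolutely_continuous P (?T P)"
      by (rule absolutely_continuousI_density) measurable
    then show ?thesis
      using assms(4) that prob_space_em_update[OF assms(2,1) P[OF that]]
      unfolding closed_under_domination_def by (metis sets_density)
  qed
  have D: "0 \<le> ?D P" "?D P = 0 \<Longrightarrow> ?T P = P" if "P \<in> \<P>" for P
  proof -
    interpret prob_space P by (rule P[OF that])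
    note em = integrable_em_density[OF assms(2,1) P[OF that]]
      integral_em_density[OF assms(2,1) P[OF that]]
      em_density_pos[OF assms(2,1) P[OF that]]
      integrable_em_density_ln[OF assms(2,1) P[OF that]]
    show "0 \<le> ?D P" by (rule expectation_mult_ln_nonneg(1)[OF em])
    assume "?D P = 0"
    then have ae: "AE x in P. ?f P x = 1" by (rule expectation_mult_ln_nonneg(2)[OF em])
    have "?T P = density P (\<lambda>_. 1)"
      by (rule density_cong) (use ae borel_measurable_integrable[OF em(1)] in auto)
    then show "?T P = P" by (simp add: density_1)
  qed
  have W_T_le: "?W (?T P) \<le> ereal (?L P)" if "P \<in> \<P>" for P
    using upper[OF that] D(1)[OF that] by (auto elim!: order_trans)
  have "(\<forall>P\<in>\<P>. ?L Phat \<le> ?L P) \<longleftrightarrow> (\<forall>P\<in>\<P>. ?W Phat \<le> ?W P)" if Phat: "Phat \<in> \<P>"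
  proof
    assume min: "\<forall>P\<in>\<P>. ?L Phat \<le> ?L P"
    \<comment> \<open>The update is itself a competitor in the class, so minimality closes the chain
      of bounds and leaves no room for a positive divergence: \<open>Phat\<close> is a fixed point
      of the EM step.\<close>
    have "ereal (?L Phat) \<le> ereal (?L (?T Phat))"
      using min T[OF Phat] by simp
    also have "\<dots> \<le> ?W (?T Phat)" by (rule lower[OF T[OF Phat]])
    also have "\<dots> \<le> ereal (?L Phat - \<sigma>\<^sup>2 * ?D Phat)" by (rule upper[OF Phat])
    finally have "\<sigma>\<^sup>2 * ?D Phat \<le> 0" by simp
    then have "?D Phat = 0"
      using D(1)[OF Phat] assms(2) by (simp add: mult_le_0_iff)
    then have T_eq: "?T Phat = Phat" by (rule D(2)[OF Phat])
    show "\<forall>P\<in>\<P>. ?W Phat \<le> ?W P"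
    proof
      fix P assume "P \<in> \<P>"
      have "?W Phat \<le> ereal (?L Phat)" using W_T_le[OF Phat] unfolding T_eq .
      also have "\<dots> \<le> ereal (?L P)" using min \<open>P \<in> \<P>\<close> by simp
      also have "\<dots> \<le> ?W P" by (rule lower) fact
      finally show "?W Phat \<le> ?W P" .
    qed
  next
    assume min: "\<forall>P\<in>\<P>. ?W Phat \<le> ?W P"
    show "\<forall>P\<in>\<P>. ?L Phat \<le> ?L P"
    proof
      fix P assume "P \<in> \<P>"
      \<comment> \<open>An arbitrary \<open>P\<close> is compared through its update, whose entropic
        cost is at most \<open>?L P\<close>.\<close>
      have "ereal (?L Phat) \<le> ?W Phat" by (rule lower[OF Phat])
      also have "\<dots> \<le> ?W (?T P)" using min T[OF \<open>P \<in> \<P>\<close>] by simp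
      also have "\<dots> \<le> ereal (?L P)" by (rule W_T_le) fact
      finally show "?L Phat \<le> ?L P" by simp
    qed
  qed
  then show ?thesis
    \<comment> \<open>Both notions say that no competitor is strictly better; by linearity of the
      orders this is the comparison with \<open>\<le>\<close> proved above.\<close>
    unfolding is_arg_max_def is_arg_min_def not_less[symmetric]
    by (auto simp: not_less log_likelihood_le_iff_scaled_nll_le[OF assms(1,2)])
qed

end
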